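(* Let $X\in[0,\infty)^{I\times J}$, let $\Pi\in[0,\infty)^{R\times J}$ have rows each summing to $1$, and let $f(B)=\sum_{i,j}\big[(B\Pi)_{ij}-x_{ij}\log (B\Pi)_{ij}\big]$ for $B\in[0,\infty)^{I\times R}$. Assume that for every $i=1,\dots,I$ the rows of the submatrix $\Pi(:,\{j: x_{ij}>0\})$ are linearly independent. Let $B_0\in[0,\infty)^{I\times R}$ be such that $f(B_0)$ is finite, let $B_{k+1}=\psi(B_k)=B_k*\Phi(B_k)$ for $k=0,1,2,\dots$, where $*$ is the elementwise product, and let $B_*$ denote the limit of the sequence $\{B_k\}$ (which exists under these assumptions). If $(B_0)_{ir}>0$ for all $(i,r)$ such that $(\Phi(B_* ))_{ir}>1$, then $\{B_k\}$ converges to the global minimizer of $f$ over $\{B\ge 0\}$.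
   Context: Convention: $0\cdot\log\mu=0$ for all $\mu\ge0$, and $f(B)=+\infty$ if $(B\Pi)_{ij}=0$ for some $(i,j)$ with $x_{ij}>0$. For $B\ge0$ with $f(B)$ finite, $\Phi(B)=[X\oslash(B\Pi)]\Pi^{\mathsf T}\in\mathbb{R}^{I\times R}$, where $\oslash$ is elementwise division; i.e. $(\Phi(B))_{ir}=\sum_{j:x_{ij}>0}\frac{x_{ij}}{(B\Pi)_{ij}}\pi_{rj}$ (entries with $x_{ij}=0$ contribute $0$). $\Pi(:,S)$ denotes the submatrix of $\Pi$ formed by the columns with index in $S$. *)

theory Defs
  imports "HOL-Analysis.Analysis"
begin

definition nonneg_mat :: "real ^ 'n ^ 'm \<Rightarrow> bool" where
  "nonneg_mat A \<longleftrightarrow> (\<forall>i j. 0 \<le> A $ i $ j)"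

text \<open>Throughout, \<open>P\<close> is the matrix written \<open>\<Pi>\<close> mathematically. The objective is an extended real so
  that the value \<open>+\<infinity>\<close> is literal; the convention that \<open>0 * log m\<close> is \<open>0\<close> even for \<open>m = 0\<close> holds
  because \<open>ln\<close> is total.\<close>

definition objective :: "real ^ 'j ^ 'i \<Rightarrow> real ^ 'j ^ 'r \<Rightarrow> real ^ 'r ^ 'i \<Rightarrow> ereal" where
  "objective X P B =
     (if \<exists>i j. 0 < X $ i $ j \<and> (B ** P) $ i $ j = 0 then \<infinity>
      else ereal (\<Sum>i\<in>UNIV. \<Sum>j\<in>UNIV. (B ** P) $ i $ j - X $ i $ j * ln ((B ** P) $ i $ j)))"

definition Phi :: "real ^ 'j ^ 'i \<Rightarrow> real ^ 'j ^ 'r \<Rightarrow> real ^ 'r ^ 'i \<Rightarrow> real ^ 'r ^ 'i" where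
  "Phi X P B = (\<chi> i r. \<Sum>j | 0 < X $ i $ j. X $ i $ j / (B ** P) $ i $ j * P $ r $ j)"

definition psi :: "real ^ 'j ^ 'i \<Rightarrow> real ^ 'j ^ 'r \<Rightarrow> real ^ 'r ^ 'i \<Rightarrow> real ^ 'r ^ 'i" where
  "psi X P B = (\<chi> i r. B $ i $ r * Phi X P B $ i $ r)"

text \<open>Linear independence of the rows of the submatrix \<open>P(:,S)\<close>. The rows are taken as an indexed
  family, so a repeated row makes them dependent; a plain \<open>independent\<close> of the set of rows would
  not see the repetition. For empty \<open>S\<close> the rows lie in the zero space and are dependent.\<close>

definition submatrix_rows_independent :: "real ^ 'j ^ 'r \<Rightarrow> 'j set \<Rightarrow> bool" where
  "submatrix_rows_independent P S \<longleftrightarrow>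
     (\<forall>c :: 'r \<Rightarrow> real. (\<forall>j\<in>S. (\<Sum>r\<in>UNIV. c r * P $ r $ j) = 0) \<longrightarrow> (\<forall>r. c r = 0))"

text \<open>The same notion through the library's \<open>independent\<close>, with the columns outside \<open>S\<close> set to zero
  since the dimension of a vector type cannot depend on \<open>S\<close>.\<close>

lemma submatrix_rows_independent_iff:
  fixes P :: "real ^ 'j ^ 'r" and S :: "'j set"
  defines "v \<equiv> \<lambda>r. (\<chi> j. if j \<in> S then P $ r $ j else 0) :: real ^ 'j"
  shows "submatrix_rows_independent P S \<longleftrightarrow> inj v \<and> independent (range v)"
proof -
  have sum_v: "(\<Sum>r\<in>UNIV. c r *\<^sub>R v r) = 0 \<longleftrightarrow> (\<forall>j\<in>S. (\<Sum>r\<in>UNIV. c r * P $ r $ j) = 0)"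
    for c :: "'r \<Rightarrow> real"
  proof -
    have "(\<Sum>r\<in>UNIV. c r *\<^sub>R v r) $ j = (if j \<in> S then \<Sum>r\<in>UNIV. c r * P $ r $ j else 0)" for j
      by (simp add: v_def)
    then show ?thesis by (auto simp: vec_eq_iff)
  qed
  have "inj v \<and> independent (range v) \<longleftrightarrow>
      (\<forall>c :: 'r \<Rightarrow> real. (\<Sum>r\<in>UNIV. c r *\<^sub>R v r) = 0 \<longrightarrow> (\<forall>r. c r = 0))" (is "?L \<longleftrightarrow> ?R")
  proof
    assume L: ?L
    show ?R
    proof (intro allI impI)
      fix c :: "'r \<Rightarrow> real" and r assume z: "(\<Sum>r\<in>UNIV. c r *\<^sub>R v r) = 0"
      have "(\<Sum>w\<in>range v. c (inv v w) *\<^sub>R w) = 0"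
        using L z by (simp add: sum.reindex)
      with L have "\<forall>w\<in>range v. c (inv v w) = 0"
        using independentD[of "range v" "range v" "\<lambda>w. c (inv v w)"] by auto
      with L show "c r = 0" by auto
    qed
  next
    assume R: ?R
    have inj: "inj v"
    proof (rule injI, rule ccontr)
      fix a b assume ab: "v a = v b" "a \<noteq> b"
      define c :: "'r \<Rightarrow> real" where "c r = (if r = a then 1 else 0) - (if r = b then 1 else 0)" for r
      have "(\<Sum>r\<in>UNIV. c r *\<^sub>R v r) = v a - v b"
        by (simp add: c_def scaleR_left_diff_distrib sum_subtractf if_distrib[of "\<lambda>t. t *\<^sub>R _"] cong: if_cong)
      with ab R have "c a = 0" by auto
      with ab show False by (simp add: c_def)
    qed
    moreover have "independent (range v)"
    proof
      assume "dependent (range v)"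
      then obtain u where u: "\<exists>w\<in>range v. u w \<noteq> 0" "(\<Sum>w\<in>range v. u w *\<^sub>R w) = 0"
        using dependent_finite[of "range v"] by auto
      then have "(\<Sum>r\<in>UNIV. u (v r) *\<^sub>R v r) = 0"
        using inj by (simp add: sum.reindex)
      with R have "\<forall>r. u (v r) = 0" by (elim allE[where x = "\<lambda>r. u (v r)"]) simp
      with u show False by auto
    qed
    ultimately show ?L by simp
  qed
  then show ?thesis by (simp add: sum_v submatrix_rows_independent_def)
qed

end

theory Submission
  imports Defs
begin

text \<open>
  The objective and the iteration both split over the rows of \<open>B\<close>, so all the work concerns one row:
  a vector \<open>b \<ge> 0\<close>, the data \<open>x\<close>, and the map \<open>step b = b * ratio b\<close>. This is the EM algorithm for
  Poisson data (the Richardson--Lucy iteration): \<open>mean b j\<close> is the model's mean \<open>(b P)\<^sub>j\<close>, and since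
  the rows of \<open>P\<close> sum to \<open>1\<close>, the cost is \<open>total b - loglik b\<close>.

  Convergence follows the argument of Csiszar and Tusnady. After one step all iterates have the
  same total mass, so they stay bounded. From then on, Jensen's inequality shows that a step raises
  \<open>loglik\<close> by at least the Kullback--Leibler divergence of the new iterate from the old one
  (\<open>gain_le_loglik_diff\<close>). So \<open>loglik\<close> converges along them, and this divergence tends to \<open>0\<close>; hence every limit point \<open>c\<close> is
  stationary. Convergence of the whole sequence comes from a second application of Jensen's
  inequality: the divergence \<open>kl c b\<close> to a stationary \<open>c\<close> that is at least as likely as \<open>b\<close> does not
  increase under a step (\<open>kl_step_le\<close>). Along the subsequence that defines \<open>c\<close> it tends to \<open>0\<close>, so by
  monotonicity it does so along the entire sequence.

  At the limit \<open>c\<close>, stationarity says that \<open>ratio c r = 1\<close> wherever \<open>c\<^sub>r > 0\<close>. The gradient of the cost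
  at \<open>c\<close> is \<open>1 - ratio c\<close>, so only \<open>ratio c \<le> 1\<close> is missing from the Karush--Kuhn--Tucker conditions.
  If \<open>ratio c r > 1\<close> and the coordinate \<open>r\<close> starts positive, it stays positive and eventually grows, so
  \<open>c\<^sub>r > 0\<close>, which contradicts \<open>ratio c r = 1\<close> there (\<open>limit_ratio_le_1\<close>). By convexity of the cost,
  the Karush--Kuhn--Tucker conditions give a global minimum, at which the means on the support of \<open>x\<close>
  are unique (\<open>kkt_minimizes\<close>); linear independence of the rows of \<open>P\<close> on this support turns
  uniqueness of the means into uniqueness of the minimizer.
\<close>

section \<open>Elementary inequalities and limits\<close>

lemma jensen_ln:
  fixes w t :: "'a \<Rightarrow> real"
  assumes "finite A" "\<And>r. r \<in> A \<Longrightarrow> 0 \<le> w r" "sum w A = 1" "\<And>r. r \<in> A \<Longrightarrow> 0 < t r"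
  shows "(\<Sum>r\<in>A. w r * ln (t r)) \<le> ln (\<Sum>r\<in>A. w r * t r)"
proof -
  have "A \<noteq> {}" using assms(3) by auto
  then show ?thesis
    using concave_on_sum[OF assms(1) _ ln_concave assms(3), of t] assms by auto
qed

text \<open>This is \<open>ln s \<le> s - 1\<close> at \<open>s = 1 / t\<close>, with the equality case.\<close>

lemma x_ln_x_ge:
  fixes t :: real
  assumes "0 < t"
  shows "t - 1 \<le> t * ln t" and "t * ln t = t - 1 \<Longrightarrow> t = 1"
proof -
  have l: "ln (1 / t) = - ln t" using assms by (simp add: ln_div)
  have "ln (1 / t) \<le> 1 / t - 1" using assms by (intro ln_le_minus_one) simp
  then have "t * (1 - 1 / t) \<le> t * ln t" using assms l by (intro mult_left_mono) auto
  then show "t - 1 \<le> t * ln t" using assms by (simp add: right_diff_distrib)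
  assume "t * ln t = t - 1"
  then have "ln (1 / t) = 1 / t - 1" using assms l by (simp add: field_simps)
  then have "1 / t = 1" using assms by (intro ln_eq_minus_one) auto
  then show "t = 1" by simp
qed

text \<open>Bounds a Kullback--Leibler term below by a squared Hellinger distance: \<open>ln s \<le> s - 1\<close> at
  \<open>s = sqrt (b / c)\<close>. The bound covers \<open>c = 0\<close> too, so small divergence controls every coordinate.\<close>

lemma sqrt_dist_le_kl_term:
  fixes c b :: real
  assumes "0 \<le> c" "0 \<le> b" "0 < c \<Longrightarrow> 0 < b"
  shows "(sqrt b - sqrt c)\<^sup>2 \<le> c * ln (c / b) - c + b"
proof (cases "c = 0")
  case True
  then show ?thesis using assms by simp
next
  case False
  then have cb: "0 < c" "0 < b" using assms by auto
  have "ln (sqrt (b / c)) \<le> sqrt (b / c) - 1" using cb by (intro ln_le_minus_one) simp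
  then have "c * ln (b / c) \<le> c * (2 * (sqrt (b / c) - 1))"
    using cb by (intro mult_left_mono) (auto simp: ln_sqrt)
  moreover have "c * sqrt (b / c) = sqrt c * sqrt b"
    using cb by (simp add: real_sqrt_divide field_simps flip: power2_eq_square)
  moreover have "ln (c / b) = - ln (b / c)" using cb by (simp add: ln_div)
  moreover have "(sqrt b - sqrt c)\<^sup>2 = b + c - 2 * (sqrt c * sqrt b)"
    using cb by (simp add: power2_diff)
  ultimately show ?thesis by (simp add: algebra_simps)
qed

lemma squeeze_zero:
  fixes f g :: "nat \<Rightarrow> real"
  assumes "\<And>n. 0 \<le> f n" "\<And>n. f n \<le> g n" "g \<longlonglongrightarrow> 0"
  shows "f \<longlonglongrightarrow> 0"
  by (rule tendsto_sandwich[OF _ _ tendsto_const assms(3)]) (simp_all add: assms(1,2))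

section \<open>The iteration on a single row\<close>

text \<open>The last hypothesis keeps \<open>ratio\<close> positive, so that an iterate never loses a positive
  coordinate after finitely many steps.\<close>

locale em_row =
  fixes x :: "real ^ 'j" and P :: "real ^ 'j ^ 'r"
  assumes x_nonneg: "\<And>j. 0 \<le> x $ j"
    and P_nonneg: "\<And>r j. 0 \<le> P $ r $ j"
    and P_sum: "\<And>r. (\<Sum>j\<in>UNIV. P $ r $ j) = 1"
    and P_hits: "\<And>r. \<exists>j. 0 < x $ j \<and> 0 < P $ r $ j"
begin

definition S :: "'j set" where "S = {j. 0 < x $ j}"

definition mean :: "real ^ 'r \<Rightarrow> 'j \<Rightarrow> real" where
  "mean b j = (\<Sum>r\<in>UNIV. b $ r * P $ r $ j)"

definition ratio :: "real ^ 'r \<Rightarrow> 'r \<Rightarrow> real" where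
  "ratio b r = (\<Sum>j\<in>S. x $ j / mean b j * P $ r $ j)"

definition step :: "real ^ 'r \<Rightarrow> real ^ 'r" where
  "step b = (\<chi> r. b $ r * ratio b r)"

definition total :: "real ^ 'r \<Rightarrow> real" where
  "total b = (\<Sum>r\<in>UNIV. b $ r)"

definition mass :: real where
  "mass = (\<Sum>j\<in>S. x $ j)"

definition loglik :: "real ^ 'r \<Rightarrow> real" where
  "loglik b = (\<Sum>j\<in>S. x $ j * ln (mean b j))"

definition cost :: "real ^ 'r \<Rightarrow> real" where
  "cost b = (\<Sum>j\<in>UNIV. mean b j - x $ j * ln (mean b j))"

definition feasible :: "real ^ 'r \<Rightarrow> bool" where
  "feasible b \<longleftrightarrow> (\<forall>r. 0 \<le> b $ r) \<and> (\<forall>j\<in>S. 0 < mean b j)"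

definition stationary :: "real ^ 'r \<Rightarrow> bool" where
  "stationary b \<longleftrightarrow> (\<forall>r. b $ r * ratio b r = b $ r)"

text \<open>Kullback--Leibler divergence \<open>kl (step b) b\<close>, written with the quotient \<open>ratio b\<close> of the two
  vectors so that coordinates where \<open>b\<close> vanishes need no case distinction.\<close>

definition gain :: "real ^ 'r \<Rightarrow> real" where
  "gain b = (\<Sum>r\<in>UNIV. b $ r * (ratio b r * ln (ratio b r) - (ratio b r - 1)))"

text \<open>Generalized Kullback--Leibler divergence, for vectors that need not sum to \<open>1\<close>. It has the
  intended value only if the support of \<open>c\<close> lies in that of \<open>b\<close>.\<close>

definition kl :: "real ^ 'r \<Rightarrow> real ^ 'r \<Rightarrow> real" where
  "kl c b = (\<Sum>r\<in>UNIV. c $ r * ln (c $ r / b $ r) - c $ r + b $ r)"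

lemma feasibleD: "feasible b \<Longrightarrow> 0 \<le> b $ r" "feasible b \<Longrightarrow> j \<in> S \<Longrightarrow> 0 < mean b j"
  by (auto simp: feasible_def)

lemma ln_mean_div:
  assumes "feasible b" "feasible c" "j \<in> S"
  shows "ln (mean b j / mean c j) = ln (mean b j) - ln (mean c j)"
  using feasibleD(2)[OF assms(1,3)] feasibleD(2)[OF assms(2,3)] by (simp add: ln_div)

lemma x_pos: "j \<in> S \<Longrightarrow> 0 < x $ j"
  by (simp add: S_def)

lemma ratio_pos:
  assumes "feasible b"
  shows "0 < ratio b r"
proof -
  obtain j where j: "0 < x $ j" "0 < P $ r $ j" using P_hits by blast
  then have "j \<in> S" by (simp add: S_def)
  then show ?thesis unfolding ratio_def
    using j feasibleD(2)[OF assms] P_nonneg x_nonneg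
    by (intro sum_pos2[of _ j]) (auto simp: less_imp_le)
qed

lemma feasible_step:
  assumes "feasible b"
  shows "feasible (step b)"
  unfolding feasible_def
proof (intro conjI allI ballI)
  show "0 \<le> step b $ r" for r
    using feasibleD(1)[OF assms] ratio_pos[OF assms] by (simp add: step_def less_imp_le)
  fix j assume "j \<in> S"
  then have "0 < mean b j" using feasibleD(2)[OF assms] by simp
  then obtain r where r: "0 < b $ r * P $ r $ j"
    unfolding mean_def by (meson not_le sum_nonpos)
  then have "0 < step b $ r * P $ r $ j"
    using mult_pos_pos[OF r ratio_pos[OF assms, of r]] by (simp add: step_def mult_ac)
  then show "0 < mean (step b) j"
    unfolding mean_def using \<open>\<And>r. 0 \<le> step b $ r\<close> P_nonneg
    by (intro sum_pos2[of _ r]) auto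
qed

lemma sum_mean: "(\<Sum>j\<in>UNIV. mean b j) = total b"
proof -
  have "(\<Sum>j\<in>UNIV. mean b j) = (\<Sum>r\<in>UNIV. \<Sum>j\<in>UNIV. b $ r * P $ r $ j)"
    unfolding mean_def by (rule sum.swap)
  then show ?thesis by (simp add: P_sum total_def flip: sum_distrib_left)
qed

lemma cost_eq: "cost b = total b - loglik b"
proof -
  have "(\<Sum>j\<in>UNIV. x $ j * ln (mean b j)) = loglik b" unfolding loglik_def
    by (rule sum.mono_neutral_right) (use x_nonneg in \<open>auto simp: S_def less_le\<close>)
  then show ?thesis by (simp add: cost_def sum_subtractf sum_mean)
qed

text \<open>Exchanging the two sums expresses \<open>ratio b\<close> paired with any vector \<open>c\<close> through the means. For
  \<open>c = b\<close> it shows that a step normalizes the total mass; for \<open>c \<noteq> b\<close> it gives the linear term of the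
  first-order expansion of \<open>loglik\<close> at \<open>b\<close>.\<close>

lemma sum_mult_ratio: "(\<Sum>r\<in>UNIV. c $ r * ratio b r) = (\<Sum>j\<in>S. x $ j * (mean c j / mean b j))"
proof -
  have "(\<Sum>r\<in>UNIV. c $ r * ratio b r) = (\<Sum>r\<in>UNIV. \<Sum>j\<in>S. c $ r * (x $ j / mean b j * P $ r $ j))"
    by (simp add: ratio_def sum_distrib_left)
  also have "\<dots> = (\<Sum>j\<in>S. \<Sum>r\<in>UNIV. c $ r * (x $ j / mean b j * P $ r $ j))"
    by (rule sum.swap)
  also have "\<dots> = (\<Sum>j\<in>S. x $ j * (mean c j / mean b j))"
    by (simp add: mean_def sum_distrib_left sum_divide_distrib mult_ac)
  finally show ?thesis .
qed

lemma total_step: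
  assumes "feasible b"
  shows "total (step b) = mass"
  using sum_mult_ratio[of b b] feasibleD(2)[OF assms]
  by (simp add: total_def step_def mass_def less_imp_neq[symmetric] cong: sum.cong)

lemma total_stationary:
  assumes "feasible c" "stationary c"
  shows "total c = mass"
proof -
  have "step c = c" using assms(2) by (simp add: step_def stationary_def vec_eq_iff)
  then show ?thesis using total_step[OF assms(1)] by simp
qed

section \<open>Monotonicity of the likelihood\<close>

text \<open>The EM inequality. For each \<open>j\<close>, the quotient \<open>mean (step b) j / mean b j\<close> is the average of
  \<open>ratio b\<close> with weights \<open>b\<^sub>r P\<^sub>r\<^sub>j / mean b j\<close>, which sum to \<open>1\<close>; Jensen's inequality bounds its
  logarithm below by the average of \<open>ln (ratio b)\<close>. Weighting by \<open>x\<^sub>j\<close> and summing over \<open>j\<close>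
  recovers \<open>ratio b\<close> as a factor.\<close>

lemma loglik_step_ge:
  assumes b: "feasible b"
  shows "loglik b + (\<Sum>r\<in>UNIV. b $ r * (ratio b r * ln (ratio b r))) \<le> loglik (step b)"
proof -
  have "(\<Sum>r\<in>UNIV. b $ r * P $ r $ j / mean b j * ln (ratio b r)) \<le> ln (mean (step b) j) - ln (mean b j)"
    if j: "j \<in> S" for j
  proof -
    have m: "0 < mean b j" "0 < mean (step b) j"
      using feasibleD(2) b feasible_step[OF b] j by auto
    have "(\<Sum>r\<in>UNIV. b $ r * P $ r $ j / mean b j * ln (ratio b r))
        \<le> ln (\<Sum>r\<in>UNIV. b $ r * P $ r $ j / mean b j * ratio b r)"
      using m feasibleD(1)[OF b] P_nonneg ratio_pos[OF b]
      by (intro jensen_ln) (auto simp: less_imp_le mean_def simp flip: sum_divide_distrib)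
    also have "(\<Sum>r\<in>UNIV. b $ r * P $ r $ j / mean b j * ratio b r) = mean (step b) j / mean b j"
      unfolding mean_def[of "step b"] by (simp add: step_def sum_divide_distrib mult_ac)
    finally show ?thesis using m by (simp add: ln_div)
  qed
  then have "(\<Sum>j\<in>S. x $ j * (\<Sum>r\<in>UNIV. b $ r * P $ r $ j / mean b j * ln (ratio b r)))
      \<le> (\<Sum>j\<in>S. x $ j * (ln (mean (step b) j) - ln (mean b j)))"
    using x_nonneg by (intro sum_mono mult_left_mono) auto
  also have "\<dots> = loglik (step b) - loglik b"
    by (simp add: loglik_def right_diff_distrib sum_subtractf)
  also have "(\<Sum>j\<in>S. x $ j * (\<Sum>r\<in>UNIV. b $ r * P $ r $ j / mean b j * ln (ratio b r)))
      = (\<Sum>j\<in>S. \<Sum>r\<in>UNIV. b $ r * (x $ j / mean b j * P $ r $ j * ln (ratio b r)))"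
    by (simp add: sum_distrib_left mult_ac)
  also have "\<dots> = (\<Sum>r\<in>UNIV. \<Sum>j\<in>S. b $ r * (x $ j / mean b j * P $ r $ j * ln (ratio b r)))"
    by (rule sum.swap)
  also have "\<dots> = (\<Sum>r\<in>UNIV. b $ r * (ratio b r * ln (ratio b r)))"
    by (simp add: ratio_def sum_distrib_left sum_distrib_right)
  finally show ?thesis by simp
qed

lemma gain_term_nonneg:
  assumes "feasible b"
  shows "0 \<le> b $ r * (ratio b r * ln (ratio b r) - (ratio b r - 1))"
  using feasibleD(1)[OF assms] x_ln_x_ge(1)[OF ratio_pos[OF assms]] by simp

lemma gain_nonneg: "feasible b \<Longrightarrow> 0 \<le> gain b"
  unfolding gain_def by (intro sum_nonneg gain_term_nonneg)

lemma gain_le_loglik_diff: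
  assumes "feasible b" "total b = mass"
  shows "gain b \<le> loglik (step b) - loglik b"
proof -
  have "gain b = (\<Sum>r\<in>UNIV. b $ r * (ratio b r * ln (ratio b r))) - (total (step b) - total b)"
    unfolding gain_def total_def step_def
    by (simp add: algebra_simps sum.distrib sum_subtractf)
  then show ?thesis using loglik_step_ge[OF assms(1)] total_step[OF assms(1)] assms(2) by simp
qed

lemma stationary_if_gain_zero:
  assumes "feasible b" "gain b = 0"
  shows "stationary b"
  unfolding stationary_def
proof
  fix r
  have "\<forall>r\<in>UNIV. b $ r * (ratio b r * ln (ratio b r) - (ratio b r - 1)) = 0"
    using assms(2) unfolding gain_def
    by (subst (asm) sum_nonneg_eq_0_iff) (auto intro: gain_term_nonneg[OF assms(1)])
  then have "b $ r = 0 \<or> ratio b r * ln (ratio b r) = ratio b r - 1" by auto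
  then show "b $ r * ratio b r = b $ r"
    using x_ln_x_ge(2)[OF ratio_pos[OF assms(1)]] by auto
qed

section \<open>Monotonicity of the divergence to a stationary point\<close>

text \<open>Jensen's inequality in the other index: if \<open>c\<^sub>r > 0\<close>, then stationarity says that the weights
  \<open>x\<^sub>j P\<^sub>r\<^sub>j / mean c j\<close> sum to \<open>1\<close> over \<open>j\<close>, and \<open>ratio b r\<close> is the average of
  \<open>mean c j / mean b j\<close> with these weights. In the sum over \<open>r\<close> with weights \<open>c\<^sub>r\<close> the factor
  \<open>mean c j\<close> cancels, and \<open>loglik c - loglik b\<close> remains.\<close>

lemma loglik_diff_le_sum_ln_ratio:
  assumes b: "feasible b" and c: "feasible c" "stationary c"
  shows "loglik c - loglik b \<le> (\<Sum>r\<in>UNIV. c $ r * ln (ratio b r))"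
proof -
  have "(\<Sum>j\<in>S. c $ r * (x $ j / mean c j * P $ r $ j * (ln (mean c j) - ln (mean b j))))
      \<le> c $ r * ln (ratio b r)" for r
  proof (cases "c $ r = 0")
    case False
    then have cr: "0 < c $ r" using feasibleD(1)[OF c(1), of r] by simp
    have "(\<Sum>j\<in>S. x $ j / mean c j * P $ r $ j) = 1"
      using c(2) cr unfolding ratio_def[symmetric] stationary_def
      by (metis less_irrefl mult_cancel_left1)
    then have "(\<Sum>j\<in>S. x $ j / mean c j * P $ r $ j * ln (mean c j / mean b j))
        \<le> ln (\<Sum>j\<in>S. x $ j / mean c j * P $ r $ j * (mean c j / mean b j))"
      using feasibleD(2)[OF b] feasibleD(2)[OF c(1)] x_nonneg P_nonneg
      by (intro jensen_ln) (auto simp: less_imp_le)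
    also have "(\<Sum>j\<in>S. x $ j / mean c j * P $ r $ j * (mean c j / mean b j)) = ratio b r"
      unfolding ratio_def
    proof (rule sum.cong)
      fix j assume "j \<in> S"
      then have "mean c j \<noteq> 0" using feasibleD(2)[OF c(1)] by fastforce
      then show "x $ j / mean c j * P $ r $ j * (mean c j / mean b j) = x $ j / mean b j * P $ r $ j"
        by simp
    qed simp
    also have "(\<Sum>j\<in>S. x $ j / mean c j * P $ r $ j * ln (mean c j / mean b j))
        = (\<Sum>j\<in>S. x $ j / mean c j * P $ r $ j * (ln (mean c j) - ln (mean b j)))"
      using ln_mean_div[OF c(1) b] by (intro sum.cong) auto
    finally show ?thesis
      unfolding sum_distrib_left[symmetric] using cr by (intro mult_left_mono) auto
  qed simp
  then have "(\<Sum>r\<in>UNIV. \<Sum>j\<in>S. c $ r * (x $ j / mean c j * P $ r $ j * (ln (mean c j) - ln (mean b j))))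
      \<le> (\<Sum>r\<in>UNIV. c $ r * ln (ratio b r))" by (intro sum_mono)
  also have "(\<Sum>r\<in>UNIV. \<Sum>j\<in>S. c $ r * (x $ j / mean c j * P $ r $ j * (ln (mean c j) - ln (mean b j))))
      = (\<Sum>j\<in>S. \<Sum>r\<in>UNIV. c $ r * (x $ j / mean c j * P $ r $ j * (ln (mean c j) - ln (mean b j))))"
    by (rule sum.swap)
  also have "\<dots> = (\<Sum>j\<in>S. mean c j * (x $ j / mean c j * (ln (mean c j) - ln (mean b j))))"
    by (simp add: mean_def[of c] sum_distrib_left sum_distrib_right sum_divide_distrib mult_ac)
  also have "\<dots> = (\<Sum>j\<in>S. x $ j * (ln (mean c j) - ln (mean b j)))"
    using feasibleD(2)[OF c(1)] by (intro sum.cong) (auto simp: less_imp_neq[symmetric])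
  also have "\<dots> = loglik c - loglik b"
    by (simp add: loglik_def right_diff_distrib sum_subtractf)
  finally show ?thesis .
qed

text \<open>The decrease of \<open>kl c\<close> in a step equals the sum of \<open>c\<^sub>r ln (ratio b r)\<close>, because the total
  mass does not change, and the preceding lemma bounds this sum below by \<open>loglik c - loglik b \<ge> 0\<close>.\<close>

lemma kl_step_le:
  assumes b: "feasible b" "total b = mass" and c: "feasible c" "stationary c"
    and supp: "\<And>r. 0 < c $ r \<Longrightarrow> 0 < b $ r" and lik: "loglik b \<le> loglik c"
  shows "kl c (step b) \<le> kl c b"
proof -
  have "c $ r * ln (c $ r / step b $ r) = c $ r * ln (c $ r / b $ r) - c $ r * ln (ratio b r)" for r
  proof (cases "c $ r = 0")
    case False
    then have "0 < c $ r" "0 < b $ r" "0 < ratio b r"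
      using feasibleD(1)[OF c(1), of r] supp[of r] ratio_pos[OF b(1)] by auto
    then show ?thesis by (simp add: step_def ln_div ln_mult algebra_simps)
  qed simp
  then have "kl c (step b) = kl c b - (\<Sum>r\<in>UNIV. c $ r * ln (ratio b r)) + (total (step b) - total b)"
    unfolding kl_def total_def by (simp add: sum.distrib sum_subtractf)
  then show ?thesis
    using loglik_diff_le_sum_ln_ratio[OF b(1) c] total_step[OF b(1)] b(2) lik by simp
qed

lemma kl_ge:
  assumes "feasible b" "feasible c" "\<And>r. 0 < c $ r \<Longrightarrow> 0 < b $ r"
  shows "(sqrt (b $ r) - sqrt (c $ r))\<^sup>2 \<le> kl c b"
proof -
  have t: "(sqrt (b $ r) - sqrt (c $ r))\<^sup>2 \<le> c $ r * ln (c $ r / b $ r) - c $ r + b $ r" for r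
    using assms feasibleD(1) by (intro sqrt_dist_le_kl_term) auto
  also have "\<dots> r \<le> kl c b" for r unfolding kl_def
    by (rule member_le_sum) (use t order_trans[OF zero_le_power2] in auto)
  finally show ?thesis .
qed

section \<open>Convergence of the iteration\<close>

lemma tendsto_mean: "a \<longlonglongrightarrow> c \<Longrightarrow> (\<lambda>n. mean (a n) j) \<longlonglongrightarrow> mean c j"
  unfolding mean_def by (intro tendsto_intros)

lemma tendsto_ratio:
  assumes "a \<longlonglongrightarrow> c" "feasible c"
  shows "(\<lambda>n. ratio (a n) r) \<longlonglongrightarrow> ratio c r"
  unfolding ratio_def
  using feasibleD(2)[OF assms(2)] by (intro tendsto_intros tendsto_mean assms) (auto simp: less_imp_neq[symmetric])

lemma tendsto_loglik:
  assumes "a \<longlonglongrightarrow> c" "feasible c"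
  shows "(\<lambda>n. loglik (a n)) \<longlonglongrightarrow> loglik c"
  unfolding loglik_def
  using feasibleD(2)[OF assms(2)] by (intro tendsto_intros tendsto_mean assms) (auto simp: less_imp_neq[symmetric])

lemma tendsto_gain:
  assumes "a \<longlonglongrightarrow> c" "feasible c"
  shows "(\<lambda>n. gain (a n)) \<longlonglongrightarrow> gain c"
  unfolding gain_def
  using ratio_pos[OF assms(2)] by (intro tendsto_intros tendsto_ratio assms) (auto simp: less_imp_neq[symmetric])

lemma tendsto_kl_self:
  assumes "a \<longlonglongrightarrow> c"
  shows "(\<lambda>n. kl c (a n)) \<longlonglongrightarrow> 0"
proof -
  have "(\<lambda>n. c $ r * ln (c $ r / a n $ r) - c $ r + a n $ r) \<longlonglongrightarrow> 0" for r
  proof -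
    have a: "(\<lambda>n. a n $ r) \<longlonglongrightarrow> c $ r" using assms by (rule tendsto_vec_nth)
    show ?thesis
    proof (cases "c $ r = 0")
      case False
      then have "(\<lambda>n. c $ r * ln (c $ r / a n $ r) - c $ r + a n $ r)
          \<longlonglongrightarrow> c $ r * ln (c $ r / c $ r) - c $ r + c $ r"
        by (intro tendsto_intros a) auto
      then show ?thesis using False by simp
    qed (use a in simp)
  qed
  then show ?thesis unfolding kl_def by (intro tendsto_null_sum)
qed

lemma mean_le_total:
  assumes "\<And>r. 0 \<le> b $ r"
  shows "mean b j \<le> total b"
proof -
  have "P $ r $ j \<le> 1" for r
    using member_le_sum[of j UNIV "\<lambda>j. P $ r $ j"] P_nonneg P_sum by simp
  then show ?thesis unfolding mean_def total_def
    using assms by (intro sum_mono mult_left_le) auto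
qed

lemma ln_mean_le:
  assumes "feasible b" "total b = mass" "j \<in> S"
  shows "ln (mean b j) \<le> ln mass"
  using mean_le_total[OF feasibleD(1)[OF assms(1)], of j] feasibleD(2)[OF assms(1,3)] assms(2)
  by (metis ln_mono)

text \<open>A mean close to \<open>0\<close> would drive \<open>loglik\<close> to \<open>-\<infinity>\<close>, as the other means are at most \<open>mass\<close>.
  Since \<open>loglik\<close> increases along the iteration, this keeps limit points feasible.\<close>

lemma mean_lower_bound:
  assumes j: "j \<in> S"
  obtains \<delta> where "0 < \<delta>"
    "\<And>b. feasible b \<Longrightarrow> total b = mass \<Longrightarrow> L \<le> loglik b \<Longrightarrow> \<delta> \<le> mean b j"
proof
  let ?K = "L - (\<Sum>i\<in>S - {j}. x $ i * ln mass)"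
  show "0 < exp (?K / x $ j)" by simp
  fix b assume b: "feasible b" "total b = mass" "L \<le> loglik b"
  have "x $ i * ln (mean b i) \<le> x $ i * ln mass" if "i \<in> S" for i
    by (intro mult_left_mono ln_mean_le b x_nonneg that)
  then have "(\<Sum>i\<in>S - {j}. x $ i * ln (mean b i)) \<le> (\<Sum>i\<in>S - {j}. x $ i * ln mass)"
    by (intro sum_mono) auto
  moreover have "loglik b = x $ j * ln (mean b j) + (\<Sum>i\<in>S - {j}. x $ i * ln (mean b i))"
    unfolding loglik_def using j by (intro sum.remove) auto
  ultimately have "?K \<le> x $ j * ln (mean b j)" using b(3) by simp
  then have "?K / x $ j \<le> ln (mean b j)" using x_pos[OF j] by (simp add: field_simps)
  then show "exp (?K / x $ j) \<le> mean b j"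
    using feasibleD(2)[OF b(1) j] by (simp add: ln_ge_iff)
qed

lemma loglik_bounded_above:
  assumes "feasible b" "total b = mass"
  shows "loglik b \<le> (\<Sum>j\<in>S. x $ j * ln mass)"
  unfolding loglik_def
  by (intro sum_mono mult_left_mono ln_mean_le assms x_nonneg)

lemma feasible_iterate:
  assumes "feasible (b 0)" "\<And>k. b (Suc k) = step (b k)"
  shows "feasible (b k)"
  by (induction k) (use assms feasible_step in auto)

lemma iterate_support:
  assumes "feasible (b 0)" "\<And>k. b (Suc k) = step (b k)"
  shows "b k $ r = 0 \<longleftrightarrow> b 0 $ r = 0"
proof (induction k)
  case (Suc k)
  then show ?case
    using ratio_pos[OF feasible_iterate[OF assms], of k r] by (simp add: assms(2) step_def)
qed simp

text \<open>The candidate limit is a limit point of the bounded sequence; as a stationary point it serves as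
  the first argument of the monotone divergence.\<close>

lemma iteration_converges:
  assumes b0: "feasible (b 0)" and bS: "\<And>k. b (Suc k) = step (b k)"
  obtains c where "b \<longlonglongrightarrow> c" "feasible c" "stationary c"
proof -
  \<comment> \<open>The total mass is normalized only after one step, hence the shift.\<close>
  define a where "a k = b (Suc k)" for k
  have aS: "a (Suc k) = step (a k)" for k by (simp add: a_def bS)
  have feas: "feasible (a k)" for k unfolding a_def by (rule feasible_iterate[OF b0 bS])
  have tot: "total (a k) = mass" for k
    unfolding a_def bS by (intro total_step feasible_iterate[OF b0 bS])
  have gain: "gain (a k) \<le> loglik (a (Suc k)) - loglik (a k)" for k
    unfolding aS by (rule gain_le_loglik_diff[OF feas tot])
  have inc: "incseq (\<lambda>k. loglik (a k))"
  proof (rule incseq_SucI)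
    show "loglik (a k) \<le> loglik (a (Suc k))" for k using gain[of k] gain_nonneg[OF feas[of k]] by simp
  qed
  obtain l where l: "(\<lambda>k. loglik (a k)) \<longlonglongrightarrow> l"
    using incseq_convergent[OF inc, of "\<Sum>j\<in>S. x $ j * ln mass"] loglik_bounded_above[OF feas tot] by blast
  have "(\<lambda>k. loglik (a (Suc k)) - loglik (a k)) \<longlonglongrightarrow> l - l"
    by (intro tendsto_diff LIMSEQ_Suc l)
  then have gain0: "(\<lambda>k. gain (a k)) \<longlonglongrightarrow> 0"
    using gain gain_nonneg[OF feas] by (intro squeeze_zero[of "\<lambda>k. gain (a k)"]) auto

  have "a k \<in> cball 0 mass" for k
    using norm_le_l1_cart[of "a k"] tot[of k] feasibleD(1)[OF feas[of k]] by (simp add: total_def)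
  then obtain c s where s: "strict_mono (s :: nat \<Rightarrow> nat)" and c: "(a \<circ> s) \<longlonglongrightarrow> c"
    using compact_imp_seq_compact[OF compact_cball[of 0 mass]] unfolding seq_compact_def by metis
  have "feasible c" unfolding feasible_def
  proof (intro conjI allI ballI)
    show "0 \<le> c $ r" for r
      by (rule LIMSEQ_le_const[OF tendsto_vec_nth[OF c]]) (auto simp: feasibleD(1)[OF feas])
    fix j assume "j \<in> S"
    from mean_lower_bound[OF this, of "loglik (a 0)"] obtain \<delta> where \<delta>: "0 < \<delta>"
      "\<And>b. feasible b \<Longrightarrow> total b = mass \<Longrightarrow> loglik (a 0) \<le> loglik b \<Longrightarrow> \<delta> \<le> mean b j"
      by blast
    have "\<delta> \<le> mean c j"
      by (rule LIMSEQ_le_const[OF tendsto_mean[OF c]]) (use \<delta>(2)[OF feas tot] inc in \<open>auto simp: incseq_def\<close>)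
    then show "0 < mean c j" using \<delta>(1) by simp
  qed
  have "gain c = 0"
    using LIMSEQ_unique[OF tendsto_gain[OF c \<open>feasible c\<close>]] LIMSEQ_subseq_LIMSEQ[OF gain0 s] by (simp add: o_def)
  then have "stationary c" by (rule stationary_if_gain_zero[OF \<open>feasible c\<close>])
  have "l = loglik c"
    using LIMSEQ_unique[OF tendsto_loglik[OF c \<open>feasible c\<close>]] LIMSEQ_subseq_LIMSEQ[OF l s] by (simp add: o_def)
  then have lik: "loglik (a k) \<le> loglik c" for k using incseq_le[OF inc l] by simp
  have supp: "0 < a k $ r" if "0 < c $ r" for k r
  proof (rule ccontr)
    assume "\<not> 0 < a k $ r"
    then have "a k $ r = 0" using feasibleD(1)[OF feas[of k], of r] by simp
    then have "a m $ r = 0" for m using iterate_support[OF b0 bS] unfolding a_def by blast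
    then have "c $ r = 0" using LIMSEQ_unique[OF tendsto_vec_nth[OF c, of r]] by simp
    then show False using that by simp
  qed
  have sqrt_kl: "(sqrt (a k $ r) - sqrt (c $ r))\<^sup>2 \<le> kl c (a k)" for k r
    by (rule kl_ge[OF feas \<open>feasible c\<close> supp])
  then have kl0: "0 \<le> kl c (a k)" for k
    by (rule order_trans[OF zero_le_power2])
  have "decseq (\<lambda>k. kl c (a k))"
    by (rule decseq_SucI) (simp add: aS kl_step_le[OF feas tot \<open>feasible c\<close> \<open>stationary c\<close> supp lik])
  then obtain d where d: "(\<lambda>k. kl c (a k)) \<longlonglongrightarrow> d"
    using decseq_convergent[of _ 0] kl0 by blast
  have "d = 0"
    using LIMSEQ_unique[OF LIMSEQ_subseq_LIMSEQ[OF d s]] tendsto_kl_self[OF c] by (simp add: o_def)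
  have "(\<lambda>k. a k $ r) \<longlonglongrightarrow> c $ r" for r
  proof -
    have "(\<lambda>k. (sqrt (a k $ r) - sqrt (c $ r))\<^sup>2) \<longlonglongrightarrow> 0"
      by (rule squeeze_zero[OF zero_le_power2 sqrt_kl d[unfolded \<open>d = 0\<close>]])
    then have "(\<lambda>k. sqrt (a k $ r) - sqrt (c $ r)) \<longlonglongrightarrow> 0"
      by (simp add: power_tendsto_0_iff)
    then have "(\<lambda>k. sqrt (a k $ r)) \<longlonglongrightarrow> sqrt (c $ r)" by (rule LIM_zero_cancel)
    then have "(\<lambda>k. (sqrt (a k $ r))\<^sup>2) \<longlonglongrightarrow> (sqrt (c $ r))\<^sup>2" by (rule tendsto_power)
    then show ?thesis using feasibleD(1)[OF feas] feasibleD(1)[OF \<open>feasible c\<close>] by simp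
  qed
  then have "a \<longlonglongrightarrow> c" by (rule vec_tendstoI)
  then have "b \<longlonglongrightarrow> c" unfolding a_def by (rule LIMSEQ_imp_Suc)
  then show thesis using \<open>feasible c\<close> \<open>stationary c\<close> by (rule that)
qed

section \<open>Optimality of the limit\<close>

text \<open>If the ratio exceeded \<open>1\<close>, stationarity would force \<open>c\<^sub>r = 0\<close>; but near \<open>c\<close> every step multiplies
  the positive coordinate \<open>r\<close> by a factor above \<open>1\<close>, so it cannot tend to \<open>0\<close>.\<close>

lemma limit_ratio_le_1:
  assumes b0: "feasible (b 0)" and bS: "\<And>k. b (Suc k) = step (b k)"
    and lim: "b \<longlonglongrightarrow> c" and c: "feasible c" "stationary c"
    and init: "1 < ratio c r \<Longrightarrow> 0 < b 0 $ r"
  shows "ratio c r \<le> 1"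
proof (rule ccontr)
  assume "\<not> ratio c r \<le> 1"
  then have gt: "1 < ratio c r" by simp
  then have "c $ r = 0" using c(2) by (auto simp: stationary_def)
  have pos: "0 < b k $ r" for k
    using init[OF gt] iterate_support[OF b0 bS, of k r] feasibleD(1)[OF feasible_iterate[OF b0 bS], of k r] by simp
  have "\<forall>\<^sub>F k in sequentially. 1 < ratio (b k) r"
    using order_tendstoD(1)[OF tendsto_ratio[OF lim c(1)] gt] .
  then obtain N where N: "\<And>k. N \<le> k \<Longrightarrow> 1 < ratio (b k) r"
    by (auto simp: eventually_sequentially)
  have "b N $ r \<le> b (N + k) $ r" for k
  proof (induction k)
    case (Suc k)
    have "b (N + k) $ r * 1 \<le> b (N + k) $ r * ratio (b (N + k)) r"
      using pos[of "N + k"] N[of "N + k"] by (intro mult_left_mono) auto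
    then show ?case using Suc by (simp add: bS step_def)
  qed simp
  then have "\<And>k. N \<le> k \<Longrightarrow> b N $ r \<le> b k $ r" by (metis le_Suc_ex)
  then have "b N $ r \<le> c $ r"
    by (intro LIMSEQ_le_const[OF tendsto_vec_nth[OF lim]]) auto
  then show False using pos[of N] \<open>c $ r = 0\<close> by simp
qed

text \<open>With \<open>t\<^sub>j = mean b j / mean c j\<close>, the difference \<open>cost b - cost c\<close> is the sum of the linear part
  \<open>\<Sum>\<^sub>r b\<^sub>r (1 - ratio c r)\<close> and the remainder \<open>\<Sum>\<^sub>j x\<^sub>j (t\<^sub>j - 1 - ln t\<^sub>j)\<close>. Both are nonnegative,
  and the remainder vanishes only if every \<open>t\<^sub>j\<close> is \<open>1\<close>.\<close>

lemma kkt_minimizes: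
  assumes c: "feasible c" "stationary c" and kkt: "\<And>r. ratio c r \<le> 1" and b: "feasible b"
  shows "cost c \<le> cost b"
    and "cost b = cost c \<Longrightarrow> j \<in> S \<Longrightarrow> mean b j = mean c j"
proof -
  define t where "t j = mean b j / mean c j" for j
  have t: "0 < t j" if "j \<in> S" for j
    using that feasibleD(2) b c by (simp add: t_def)
  have nn: "0 \<le> x $ j * (t j - 1 - ln (t j))" if "j \<in> S" for j
    using x_nonneg[of j] ln_le_minus_one[OF t[OF that]] by simp
  have "loglik b - loglik c = (\<Sum>j\<in>S. x $ j * ln (t j))"
    unfolding loglik_def sum_subtractf[symmetric] t_def
    by (simp add: ln_mean_div[OF b c(1)] right_diff_distrib)
  moreover have "(\<Sum>j\<in>S. x $ j * t j) = (\<Sum>r\<in>UNIV. b $ r * ratio c r)"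
    by (simp add: sum_mult_ratio t_def)
  ultimately have diff: "cost b - cost c
      = (total b - (\<Sum>r\<in>UNIV. b $ r * ratio c r)) + (\<Sum>j\<in>S. x $ j * (t j - 1 - ln (t j)))"
    using total_stationary[OF c]
    by (simp add: cost_eq mass_def right_diff_distrib sum_subtractf)
  have nonneg: "0 \<le> (\<Sum>j\<in>S. x $ j * (t j - 1 - ln (t j)))" by (rule sum_nonneg[OF nn])
  have lin: "(\<Sum>r\<in>UNIV. b $ r * ratio c r) \<le> total b"
    unfolding total_def using feasibleD(1)[OF b] kkt by (intro sum_mono mult_left_le) auto
  show "cost c \<le> cost b" using diff lin nonneg by simp
  assume "cost b = cost c" "j \<in> S"
  then have "(\<Sum>j\<in>S. x $ j * (t j - 1 - ln (t j))) = 0"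
    using diff lin nonneg by simp
  then have "x $ j * (t j - 1 - ln (t j)) = 0"
    using \<open>j \<in> S\<close> nn by (subst (asm) sum_nonneg_eq_0_iff) auto
  then have "ln (t j) = t j - 1" using x_pos[OF \<open>j \<in> S\<close>] by simp
  then have "t j = 1" using ln_eq_minus_one[OF t[OF \<open>j \<in> S\<close>]] by simp
  then show "mean b j = mean c j" using feasibleD(2)[OF c(1) \<open>j \<in> S\<close>] by (simp add: t_def)
qed

lemma eq_if_mean_eq:
  assumes "submatrix_rows_independent P S" "\<And>j. j \<in> S \<Longrightarrow> mean b j = mean c j"
  shows "b = c"
proof -
  have "(\<Sum>r\<in>UNIV. (b $ r - c $ r) * P $ r $ j) = 0" if "j \<in> S" for j
    using assms(2)[OF that] by (simp add: mean_def left_diff_distrib sum_subtractf)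
  then have "\<forall>r. b $ r - c $ r = 0"
    using assms(1)[unfolded submatrix_rows_independent_def, rule_format, of "\<lambda>r. b $ r - c $ r"] by blast
  then show ?thesis by (simp add: vec_eq_iff)
qed

end

section \<open>Assembling the rows\<close>

text \<open>A row of \<open>P\<close> that vanishes on the support of \<open>x\<close> would by itself be linearly dependent.\<close>

lemma em_row_of_independent:
  fixes x :: "real ^ 'j" and P :: "real ^ 'j ^ 'r"
  assumes "\<And>j. 0 \<le> x $ j" "nonneg_mat P" "\<And>r. (\<Sum>j\<in>UNIV. P $ r $ j) = 1"
    and ind: "submatrix_rows_independent P {j. 0 < x $ j}"
  shows "em_row x P"
proof
  show "\<exists>j. 0 < x $ j \<and> 0 < P $ r $ j" for r
  proof (rule ccontr)
    assume "\<nexists>j. 0 < x $ j \<and> 0 < P $ r $ j"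
    then have z: "P $ r $ j = 0" if "0 < x $ j" for j
      using that assms(2) by (metis nonneg_mat_def order_less_le)
    define c :: "'r \<Rightarrow> real" where "c q = (if q = r then 1 else 0)" for q
    have "\<forall>j\<in>{j. 0 < x $ j}. (\<Sum>q\<in>UNIV. c q * P $ q $ j) = 0"
      using z by (simp add: c_def if_distrib[of "\<lambda>t. t * _"] cong: if_cong)
    then have "c r = 0" using ind by (auto simp: submatrix_rows_independent_def)
    then show False by (simp add: c_def)
  qed
qed (use assms in \<open>auto simp: nonneg_mat_def\<close>)

theorem theorem4p3:
  fixes X :: "real ^ 'j ^ 'i" and P :: "real ^ 'j ^ 'r" and B :: "nat \<Rightarrow> real ^ 'r ^ 'i"
  assumes "nonneg_mat X"
    and "nonneg_mat P"
    and "\<forall>r. (\<Sum>j\<in>UNIV. P $ r $ j) = 1"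
    and "\<forall>i. submatrix_rows_independent P {j. 0 < X $ i $ j}"
    and "nonneg_mat (B 0)"
    and "\<bar>objective X P (B 0)\<bar> \<noteq> \<infinity>"
    and "\<forall>k. B (Suc k) = psi X P (B k)"
  shows "\<exists>Blim. B \<longlonglongrightarrow> Blim \<and>
           ((\<forall>i r. 1 < Phi X P Blim $ i $ r \<longrightarrow> 0 < B 0 $ i $ r) \<longrightarrow>
              is_arg_min (objective X P) nonneg_mat Blim \<and>
              (\<forall>C. is_arg_min (objective X P) nonneg_mat C \<longrightarrow> C = Blim))"
proof -
  have loc: "em_row (X $ i) P" for i
    using assms by (intro em_row_of_independent) (auto simp: nonneg_mat_def)
  note defs = em_row.mean_def[OF loc] em_row.ratio_def[OF loc] em_row.step_def[OF loc] em_row.S_def[OF loc]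
  have mean: "(C ** P) $ i $ j = em_row.mean P (C $ i) j" for C :: "real ^ 'r ^ 'i" and i j
    by (simp add: matrix_matrix_mult_def defs)
  have phi: "Phi X P C $ i $ r = em_row.ratio (X $ i) P (C $ i) r" for C i r
    by (simp add: Phi_def mean defs(2,4))
  have step: "B (Suc k) $ i = em_row.step (X $ i) P (B k $ i)" for k i
    using assms(7) by (simp add: psi_def phi defs(3) vec_eq_iff)
  have feasible_iff: "(\<forall>i. em_row.feasible (X $ i) P (C $ i)) \<longleftrightarrow> nonneg_mat C \<and> objective X P C \<noteq> \<infinity>" for C
  proof -
    have "0 \<le> (C ** P) $ i $ j" if "nonneg_mat C" for i j
      using that assms(2) by (auto simp: nonneg_mat_def matrix_matrix_mult_def intro!: sum_nonneg)
    then show ?thesis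
      unfolding em_row.feasible_def[OF loc] mean[symmetric] defs(4) objective_def nonneg_mat_def
      by (auto simp: less_le dest: sym)
  qed
  have objective: "objective X P C = ereal (\<Sum>i\<in>UNIV. em_row.cost (X $ i) P (C $ i))"
    if "\<And>i. em_row.feasible (X $ i) P (C $ i)" for C
    using feasible_iff[of C] that unfolding objective_def em_row.cost_def[OF loc] mean[symmetric]
    by (auto split: if_splits)
  have feas0: "em_row.feasible (X $ i) P (B 0 $ i)" for i
    using feasible_iff[of "B 0"] assms(5,6) by auto
  have "\<exists>c. (\<lambda>k. B k $ i) \<longlonglongrightarrow> c \<and> em_row.feasible (X $ i) P c \<and> em_row.stationary (X $ i) P c" for i
    by (rule em_row.iteration_converges[OF loc[of i], of "\<lambda>k. B k $ i"]) (use feas0 step in auto)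
  then obtain c where c: "\<And>i. (\<lambda>k. B k $ i) \<longlonglongrightarrow> c i" "\<And>i. em_row.feasible (X $ i) P (c i)"
    "\<And>i. em_row.stationary (X $ i) P (c i)" by metis
  define Blim where "Blim = (\<chi> i. c i)"
  have Blim[simp]: "Blim $ i = c i" for i by (simp add: Blim_def)
  have "B \<longlonglongrightarrow> Blim" by (rule vec_tendstoI) (simp add: c(1))
  moreover have "is_arg_min (objective X P) nonneg_mat Blim \<and>
      (\<forall>C. is_arg_min (objective X P) nonneg_mat C \<longrightarrow> C = Blim)"
    if init: "\<forall>i r. 1 < Phi X P Blim $ i $ r \<longrightarrow> 0 < B 0 $ i $ r"
  proof -
    have kkt: "em_row.ratio (X $ i) P (c i) r \<le> 1" for i r
      by (rule em_row.limit_ratio_le_1[OF loc[of i], of "\<lambda>k. B k $ i" "c i" r])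
        (use feas0 step c init in \<open>auto simp: phi\<close>)
    have cost_le: "em_row.cost (X $ i) P (c i) \<le> em_row.cost (X $ i) P b"
      if "em_row.feasible (X $ i) P b" for i b
      using em_row.kkt_minimizes(1)[OF loc c(2,3) kkt that] .
    have obj_Blim: "objective X P Blim = ereal (\<Sum>i\<in>UNIV. em_row.cost (X $ i) P (c i))"
      using objective[of Blim] c(2) by simp
    have "objective X P Blim \<le> objective X P C" if C: "nonneg_mat C" for C
    proof (cases "objective X P C = \<infinity>")
      case False
      then have "em_row.feasible (X $ i) P (C $ i)" for i using feasible_iff[of C] C by blast
      then show ?thesis by (simp add: objective obj_Blim sum_mono cost_le)
    qed simp
    moreover have "nonneg_mat Blim" using feasible_iff[of Blim] c(2) by simp
    ultimately have min: "is_arg_min (objective X P) nonneg_mat Blim"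
      by (simp add: is_arg_min_linorder)
    moreover have "C = Blim" if C: "is_arg_min (objective X P) nonneg_mat C" for C
    proof -
      have eq: "objective X P C = objective X P Blim" and "nonneg_mat C"
        using C min by (auto simp: is_arg_min_linorder intro: antisym)
      then have feas: "em_row.feasible (X $ i) P (C $ i)" for i
        using feasible_iff[of C] obj_Blim by auto
      have "(\<Sum>i\<in>UNIV. em_row.cost (X $ i) P (C $ i)) = (\<Sum>i\<in>UNIV. em_row.cost (X $ i) P (c i))"
        using eq objective[OF feas] obj_Blim by simp
      then have "em_row.cost (X $ i) P (C $ i) = em_row.cost (X $ i) P (c i)" for i
        using sum_mono_inv[of "\<lambda>i. em_row.cost (X $ i) P (c i)" UNIV "\<lambda>i. em_row.cost (X $ i) P (C $ i)" i]
          cost_le[OF feas] by simp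
      then have "C $ i = c i" for i
        using em_row.kkt_minimizes(2)[OF loc c(2,3) kkt feas] assms(4)
        by (intro em_row.eq_if_mean_eq[OF loc]) (auto simp: defs(4))
      then show ?thesis by (simp add: vec_eq_iff)
    qed
    ultimately show ?thesis by blast
  qed
  ultimately show ?thesis by blast
qed

end
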